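(* Let $\mathcal{C}$ be an $(n,\alpha,\theta,\rho)$-FR code. Define $g'(\ell)$ for $\ell=1,\ldots,\theta$ recursively by $$g'(1)=\rho,\qquad g'(\ell+1)=g'(\ell)+\rho-\left\lceil\frac{\alpha g'(\ell)-\ell\rho}{\theta-\ell}\right\rceil\quad\text{for }\ell=1,2,\ldots,\theta-1.$$ Then for all $k=1,2,\ldots,n$, $$M_k(\mathcal{C})\le\sum_{\ell=1}^{\theta}\mathbb{I}\bigl(k>n-g'(\ell)\bigr),$$ where $\mathbb{I}(\cdot)$ equals $1$ if the condition in the parentheses is true and $0$ otherwise.
   Context: An incidence structure is a triple $(P,\mathcal{B},\mathcal{I})$ with $P$ (points) and $\mathcal{B}$ (blocks) nonempty finite sets and $\mathcal{I}\subseteq P\times\mathcal{B}$; a point $p$ is incident with a block $B$ if $(p,B)\in\mathcal{I}$. Distinct blocks are allowed to be incident with the same set of points. For positive integers $n,\alpha,\theta,\rho$, an $(n,\alpha,\theta,\rho)$-FR (fractional repetition) code is an incidence structure with $|P|=\theta$, $|\mathcal{B}|=n$, every block incident with exactly $\alpha$ points, and every point incident with exactly $\rho$ blocks. For an FR code $\mathcal{C}=(P,\mathcal{B},\mathcal{I})$ and $1\le k\le|\mathcal{B}|$, the supported file size is $$M_k(\mathcal{C})=\min_{\mathcal{K}\subseteq\mathcal{B},\,|\mathcal{K}|=k}\bigl|\{p\in P:\exists B\in\mathcal{K},\ (p,B)\in\mathcal{I}\}\bigr|.$$ *)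

theory Defs
  imports Complex_Main
begin

(* Blocks are abstract objects rather than point sets, so distinct blocks may be
   incident with the same points. *)
locale incidence_structure =
  fixes P :: "'p set" and B :: "'b set" and I :: "('p \<times> 'b) set"
  assumes finite_points: "finite P"
    and finite_blocks: "finite B"
    and points_nonempty: "P \<noteq> {}"
    and blocks_nonempty: "B \<noteq> {}"
    and incidence_subset: "I \<subseteq> P \<times> B"

locale FR_code = incidence_structure P B I
  for P :: "'p set" and B :: "'b set" and I :: "('p \<times> 'b) set" +
  fixes n \<alpha> \<theta> \<rho> :: nat
  assumes params_pos: "n > 0" "\<alpha> > 0" "\<theta> > 0" "\<rho> > 0"
    and card_points: "card P = \<theta>"
    and card_blocks: "card B = n"
    and block_degree: "\<And>b. b \<in> B \<Longrightarrow> card {p \<in> P. (p, b) \<in> I} = \<alpha>"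
    and point_degree: "\<And>p. p \<in> P \<Longrightarrow> card {b \<in> B. (p, b) \<in> I} = \<rho>"

(* Meaningful for 1 <= k <= card B. *)
definition supported_file_size ::
  "'p set \<Rightarrow> 'b set \<Rightarrow> ('p \<times> 'b) set \<Rightarrow> nat \<Rightarrow> nat" where
  "supported_file_size P B I k =
     Min {card {p \<in> P. \<exists>b\<in>K. (p, b) \<in> I} | K. K \<subseteq> B \<and> card K = k}"

(* Only the indices 1, ..., \<theta> are meaningful; the value at 0 is a dummy. *)
fun g' :: "nat \<Rightarrow> nat \<Rightarrow> nat \<Rightarrow> nat \<Rightarrow> int" where
  "g' \<alpha> \<theta> \<rho> 0 = 0"
| "g' \<alpha> \<theta> \<rho> (Suc 0) = int \<rho>"
| "g' \<alpha> \<theta> \<rho> (Suc (Suc m)) =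
     (let l = Suc m; x = g' \<alpha> \<theta> \<rho> l
      in x + int \<rho> -
         \<lceil>(real \<alpha> * real_of_int x - real l * real \<rho>) / (real \<theta> - real l)\<rceil>)"

end

theory Submission
  imports Defs
begin

text \<open>
  Work with the dual quantity: the number of blocks met by a set of points. Given \<open>\<ell>\<close> points
  meeting \<open>x\<close> blocks, double counting gives \<open>\<alpha> x - \<ell> \<rho>\<close> incidences between these blocks and the
  remaining \<open>\<theta> - \<ell>\<close> points, so adding the best of the latter shows that some \<open>\<ell> + 1\<close> points meet
  at most \<open>x + \<rho> - \<lceil>(\<alpha> x - \<ell> \<rho>) / (\<theta> - \<ell>)\<rceil>\<close> blocks. This expression is monotone in \<open>x\<close> only
  for \<open>\<alpha> \<le> \<theta> - \<ell>\<close>; but for \<open>\<alpha> > \<theta> - \<ell>\<close> any \<open>\<ell>\<close> points meet all \<open>n\<close> blocks, and \<open>n\<close> is a fixed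
  point of the recursion. Hence some \<open>\<ell>\<close> points meet at most \<open>g'(\<ell>) \<le> n\<close> blocks, for every \<open>\<ell>\<close>.
  Finally, if \<open>g'(\<ell>) \<le> n - k\<close>, then \<open>k\<close> of the blocks avoid \<open>\<ell>\<close> points, so \<open>M\<^sub>k \<le> \<theta> - \<ell>\<close>; it remains
  to take the largest such \<open>\<ell>\<close>.
\<close>

text \<open>One step of the recursion with the previous value freed as \<open>x\<close>, so that it
  can be compared at a true block count, at \<open>g'\<close> and at \<open>n\<close>.\<close>

definition greedy_step :: "nat \<Rightarrow> nat \<Rightarrow> nat \<Rightarrow> nat \<Rightarrow> int \<Rightarrow> int" where
  "greedy_step \<alpha> \<theta> \<rho> l x =
     x + int \<rho> - \<lceil>(real \<alpha> * real_of_int x - real l * real \<rho>) / (real \<theta> - real l)\<rceil>"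

lemma g'_Suc: "l > 0 \<Longrightarrow> g' \<alpha> \<theta> \<rho> (Suc l) = greedy_step \<alpha> \<theta> \<rho> l (g' \<alpha> \<theta> \<rho> l)"
  by (cases l) (auto simp: greedy_step_def Let_def)

text \<open>The quotient has slope \<alpha> / (\<theta> - l), here at most 1. It therefore grows by
  at most y - x, and this integer shift passes through the ceiling.\<close>

lemma greedy_step_mono:
  assumes "x \<le> y" "\<alpha> + l \<le> \<theta>" "l < \<theta>"
  shows "greedy_step \<alpha> \<theta> \<rho> l x \<le> greedy_step \<alpha> \<theta> \<rho> l y"
proof -
  let ?d = "real \<theta> - real l"
  let ?q = "\<lambda>x::int. (real \<alpha> * real_of_int x - real l * real \<rho>) / ?d"
  have d: "?d > 0" "real \<alpha> \<le> ?d" using assms by linarith+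
  have *: "real \<alpha> * (real_of_int y - real_of_int x) \<le> ?d * (real_of_int y - real_of_int x)"
    using d assms(1) by (intro mult_right_mono) auto
  have "?q y \<le> ?q x + real_of_int (y - x)"
  proof -
    have "?q y - ?q x = real \<alpha> * (real_of_int y - real_of_int x) / ?d"
      by (simp add: diff_divide_distrib[symmetric] algebra_simps)
    also have "\<dots> \<le> real_of_int (y - x)"
      using * d(1) by (simp add: pos_divide_le_eq mult.commute)
    finally show ?thesis by simp
  qed
  hence "\<lceil>?q y\<rceil> \<le> \<lceil>?q x + real_of_int (y - x)\<rceil>"
    by (rule ceiling_mono)
  also have "\<dots> = \<lceil>?q x\<rceil> + (y - x)"
    by (rule ceiling_add_of_int)
  finally show ?thesis
    unfolding greedy_step_def by linarith
qed

context FR_code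
begin

definition blocks_meeting :: "'p set \<Rightarrow> 'b set" where
  "blocks_meeting S = {b \<in> B. \<exists>p\<in>S. (p, b) \<in> I}"

lemma blocks_meeting_subset: "blocks_meeting S \<subseteq> B"
  by (auto simp: blocks_meeting_def)

lemma finite_blocks_meeting: "finite (blocks_meeting S)"
  using blocks_meeting_subset finite_blocks by (rule finite_subset)

lemma card_blocks_meeting_le: "card (blocks_meeting S) \<le> n"
  using card_mono[OF finite_blocks blocks_meeting_subset] card_blocks by simp

lemma sum_point_degrees_within:
  assumes "C \<subseteq> B"
  shows "(\<Sum>p\<in>P. card {b \<in> C. (p, b) \<in> I}) = \<alpha> * card C"
proof -
  have "(\<Sum>p\<in>P. card {b \<in> C. (p, b) \<in> I}) = (\<Sum>b\<in>C. \<alpha>)"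
    using assms finite_points finite_blocks block_degree
    by (intro sum_multicount_gen) (auto intro: finite_subset)
  thus ?thesis by simp
qed

lemma incidence_count: "\<alpha> * n = \<theta> * \<rho>"
  using sum_point_degrees_within[of B] point_degree card_points card_blocks by simp

text \<open>By \<open>incidence_count\<close> the numerator is (\<theta> - l) \<rho>, so the
  quotient is exactly \<rho> and cancels the added \<rho>.\<close>

lemma greedy_step_all_blocks:
  assumes "l < \<theta>"
  shows "greedy_step \<alpha> \<theta> \<rho> l (int n) = int n"
proof -
  have "real \<alpha> * real n = real \<theta> * real \<rho>"
    using incidence_count by (metis of_nat_mult)
  hence "(real \<alpha> * real n - real l * real \<rho>) / (real \<theta> - real l) = of_int (int \<rho>)"
    using assms by (simp add: field_simps)
  thus ?thesis
    unfolding greedy_step_def by (simp only: of_int_of_nat_eq ceiling_of_nat)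
qed

text \<open>A block avoiding S would need \<alpha> points outside S, but fewer than \<alpha> remain
  there.\<close>

lemma blocks_meeting_large:
  assumes "S \<subseteq> P" "\<theta> < \<alpha> + card S"
  shows "blocks_meeting S = B"
proof -
  have "\<exists>p\<in>S. (p, b) \<in> I" if b: "b \<in> B" for b
  proof (rule ccontr)
    assume *: "\<not> (\<exists>p\<in>S. (p, b) \<in> I)"
    have fin: "finite S" "finite {p \<in> P. (p, b) \<in> I}"
      using assms(1) finite_points by (auto intro: finite_subset)
    have "card (S \<union> {p \<in> P. (p, b) \<in> I}) = card S + \<alpha>"
      using * fin block_degree[OF b] by (subst card_Un_disjoint) auto
    moreover have "card (S \<union> {p \<in> P. (p, b) \<in> I}) \<le> \<theta>"
      unfolding card_points[symmetric] using assms(1) finite_points by (intro card_mono) auto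
    ultimately show False using assms(2) by simp
  qed
  thus ?thesis by (auto simp: blocks_meeting_def)
qed

text \<open>Inclusion-exclusion: the blocks through p that S already meets are counted twice on the
  right.\<close>

lemma card_blocks_meeting_insert:
  assumes "p \<in> P"
  shows "card (blocks_meeting (insert p S)) + card {b \<in> blocks_meeting S. (p, b) \<in> I}
           = card (blocks_meeting S) + \<rho>"
proof -
  have "blocks_meeting (insert p S) = blocks_meeting S \<union> {b \<in> B. (p, b) \<in> I}"
    and "{b \<in> blocks_meeting S. (p, b) \<in> I} = blocks_meeting S \<inter> {b \<in> B. (p, b) \<in> I}"
    by (auto simp: blocks_meeting_def)
  moreover have "finite {b \<in> B. (p, b) \<in> I}"
    using finite_blocks by simp
  ultimately show ?thesis
    using card_Un_Int[OF finite_blocks_meeting[of S], of "{b \<in> B. (p, b) \<in> I}"]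
      point_degree[OF assms] by simp
qed

text \<open>Every block through a point of S meets S, so each point of S accounts for \<rho> of the
  incidences with \<open>blocks_meeting S\<close>.\<close>

lemma sum_degrees_outside:
  assumes "S \<subseteq> P"
  shows "(\<Sum>p\<in>P - S. card {b \<in> blocks_meeting S. (p, b) \<in> I}) + card S * \<rho>
           = \<alpha> * card (blocks_meeting S)"
proof -
  let ?c = "\<lambda>p. card {b \<in> blocks_meeting S. (p, b) \<in> I}"
  have "?c p = \<rho>" if "p \<in> S" for p
  proof -
    have "{b \<in> blocks_meeting S. (p, b) \<in> I} = {b \<in> B. (p, b) \<in> I}"
      using that by (auto simp: blocks_meeting_def)
    thus ?thesis using that assms point_degree by auto
  qed
  hence "sum ?c S = card S * \<rho>" by simp
  thus ?thesis
    using sum.subset_diff[OF assms finite_points, of ?c]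
      sum_point_degrees_within[OF blocks_meeting_subset] by simp
qed

text \<open>Averaging: the \<open>?d\<close> points outside S share \<open>?e\<close> incidences
  with the blocks already met, so some p has at least \<open>?e / ?d\<close> of them. Its count is
  an integer, hence at least the ceiling.\<close>

lemma exists_greedy_point:
  assumes "S \<subseteq> P" "card S < \<theta>"
  obtains p where "p \<in> P - S"
    "int (card (blocks_meeting (insert p S)))
       \<le> greedy_step \<alpha> \<theta> \<rho> (card S) (int (card (blocks_meeting S)))"
proof -
  let ?c = "\<lambda>p. card {b \<in> blocks_meeting S. (p, b) \<in> I}"
  let ?e = "real \<alpha> * real (card (blocks_meeting S)) - real (card S) * real \<rho>"
  let ?d = "real \<theta> - real (card S)"
  have fin: "finite S" using assms(1) finite_points by (rule finite_subset)
  have card_diff: "real (card (P - S)) = ?d"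
    using assms fin card_points by (simp add: card_Diff_subset of_nat_diff)
  have "real (sum ?c (P - S) + card S * \<rho>) = real (\<alpha> * card (blocks_meeting S))"
    using sum_degrees_outside[OF assms(1)] by (rule arg_cong)
  hence total: "real (sum ?c (P - S)) = ?e" by simp
  have "\<exists>p\<in>P - S. ?e / ?d \<le> real (?c p)"
  proof (rule ccontr)
    assume "\<not> ?thesis"
    hence less: "\<And>p. p \<in> P - S \<Longrightarrow> real (?c p) < ?e / ?d" by force
    have "P - S \<noteq> {}" using card_diff assms(2) by (metis card.empty diff_gt_0_iff_gt
          less_irrefl of_nat_0 of_nat_less_iff)
    hence "(\<Sum>p\<in>P - S. real (?c p)) < (\<Sum>p\<in>P - S. ?e / ?d)"
      using finite_points less by (intro sum_strict_mono) auto
    also have "\<dots> = ?e" using card_diff assms(2) by simp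
    finally show False using total by simp
  qed
  then obtain p where p: "p \<in> P - S" "?e / ?d \<le> real (?c p)" by blast
  have "\<lceil>?e / ?d\<rceil> \<le> int (?c p)"
    using p(2) by (simp add: ceiling_le_iff)
  moreover have "int (card (blocks_meeting (insert p S))) + int (?c p)
                   = int (card (blocks_meeting S)) + int \<rho>"
    using card_blocks_meeting_insert[of p S] p(1) by (metis DiffD1 of_nat_add)
  ultimately show ?thesis
    using that[OF p(1)] unfolding greedy_step_def by simp
qed

lemma exists_points_meeting_few_blocks:
  assumes "1 \<le> l" "l \<le> \<theta>"
  shows "g' \<alpha> \<theta> \<rho> l \<le> int n \<and>
         (\<exists>S\<subseteq>P. card S = l \<and> int (card (blocks_meeting S)) \<le> g' \<alpha> \<theta> \<rho> l)"
  using assms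
proof (induction l rule: dec_induct)
  case base
  obtain p where p: "p \<in> P" using points_nonempty by blast
  have meeting: "card (blocks_meeting {p}) = \<rho>"
    using point_degree[OF p] by (simp add: blocks_meeting_def)
  moreover have "\<rho> \<le> n" using card_blocks_meeting_le[of "{p}"] meeting by simp
  ultimately show ?case
    using p by (auto intro!: exI[of _ "{p}"])
next
  case (step l)
  let ?f = "greedy_step \<alpha> \<theta> \<rho> l"
  let ?g = "g' \<alpha> \<theta> \<rho> l"
  from step obtain S where S: "S \<subseteq> P" "card S = l" "int (card (blocks_meeting S)) \<le> ?g"
    and g: "?g \<le> int n" by auto
  have l: "l < \<theta>" using step by simp
  have bounds: "?f (int (card (blocks_meeting S))) \<le> ?f ?g" "?f ?g \<le> ?f (int n)"
  proof -
    \<comment> \<open>In the second case S meets all blocks, so \<open>?g\<close> is squeezed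
      between n and n; all three arguments of \<open>?f\<close> coincide.\<close>
    consider "\<alpha> + l \<le> \<theta>" | "\<theta> < \<alpha> + l" by linarith
    hence "?f (int (card (blocks_meeting S))) \<le> ?f ?g \<and> ?f ?g \<le> ?f (int n)"
    proof cases
      case 1
      thus ?thesis using S(3) g l by (simp add: greedy_step_mono)
    next
      case 2
      hence "card (blocks_meeting S) = n"
        using blocks_meeting_large S card_blocks by simp
      moreover from this have "?g = int n" using S(3) g by simp
      ultimately show ?thesis by simp
    qed
    thus "?f (int (card (blocks_meeting S))) \<le> ?f ?g" "?f ?g \<le> ?f (int n)" by auto
  qed
  obtain p where p: "p \<in> P - S"
    "int (card (blocks_meeting (insert p S))) \<le> ?f (int (card (blocks_meeting S)))"
    using exists_greedy_point[OF S(1)] S(2) l by metis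
  have "card (insert p S) = Suc l"
    using p(1) S finite_subset[OF S(1) finite_points] by simp
  hence "\<exists>S\<subseteq>P. card S = Suc l \<and> int (card (blocks_meeting S)) \<le> ?f ?g"
    using p S(1) bounds(1) by (intro exI[of _ "insert p S"]) auto
  thus ?case
    using g'_Suc[of l] step.hyps bounds(2) greedy_step_all_blocks[OF l] by simp
qed

lemma supported_file_size_le:
  assumes "K \<subseteq> B" "card K = k"
  shows "supported_file_size P B I k \<le> card {p \<in> P. \<exists>b\<in>K. (p, b) \<in> I}"
  unfolding supported_file_size_def
proof (rule Min_le)
  have "{card {p \<in> P. \<exists>b\<in>K. (p, b) \<in> I} | K. K \<subseteq> B \<and> card K = k}
          \<subseteq> (\<lambda>K. card {p \<in> P. \<exists>b\<in>K. (p, b) \<in> I}) ` Pow B" by auto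
  thus "finite {card {p \<in> P. \<exists>b\<in>K. (p, b) \<in> I} | K. K \<subseteq> B \<and> card K = k}"
    using finite_blocks by (auto intro: finite_subset)
qed (use assms in auto)

text \<open>Choose k blocks among those that avoid S; the points they cover lie in P - S.\<close>

lemma supported_file_size_le_diff:
  assumes S: "S \<subseteq> P" and k: "k + card (blocks_meeting S) \<le> n"
  shows "supported_file_size P B I k \<le> \<theta> - card S"
proof -
  have "k \<le> card (B - blocks_meeting S)"
    using k card_blocks finite_blocks_meeting blocks_meeting_subset
    by (simp add: card_Diff_subset)
  then obtain K where K: "K \<subseteq> B - blocks_meeting S" "card K = k"
    by (meson obtain_subset_with_card_n)
  have "{p \<in> P. \<exists>b\<in>K. (p, b) \<in> I} \<subseteq> P - S"
    using K(1) by (auto simp: blocks_meeting_def)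
  hence "card {p \<in> P. \<exists>b\<in>K. (p, b) \<in> I} \<le> card (P - S)"
    using finite_points by (intro card_mono) auto
  also have "\<dots> = \<theta> - card S"
    using S finite_points card_points by (simp add: card_Diff_subset finite_subset)
  finally show ?thesis
    using supported_file_size_le[of K k] K by (meson Diff_subset le_trans subset_trans)
qed

end

theorem theorem5:
  fixes P :: "'p set" and B :: "'b set" and I :: "('p \<times> 'b) set"
    and n \<alpha> \<theta> \<rho> :: nat
  assumes "FR_code P B I n \<alpha> \<theta> \<rho>"
  shows "\<forall>k\<in>{1..n}. supported_file_size P B I k
           \<le> (\<Sum>l = 1..\<theta>. of_bool (int k > int n - g' \<alpha> \<theta> \<rho> l))"
proof
  fix k assume k: "k \<in> {1..n}"
  interpret FR_code P B I n \<alpha> \<theta> \<rho> by (rule assms)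
  let ?g = "g' \<alpha> \<theta> \<rho>"
  \<comment> \<open>Including 0 keeps the maximum defined when no index qualifies; it corresponds to
    the empty point set, which meets no block.\<close>
  define A where "A = insert 0 {l \<in> {1..\<theta>}. ?g l \<le> int n - int k}"
  define L where "L = Max A"
  have A: "finite A" "A \<noteq> {}" by (auto simp: A_def)
  have "L \<in> A" unfolding L_def using A by (rule Max_in)
  have "\<exists>S\<subseteq>P. card S = L \<and> k + card (blocks_meeting S) \<le> n"
  proof (cases "L = 0")
    case True
    thus ?thesis using k by (intro exI[of _ "{}"]) (auto simp: blocks_meeting_def)
  next
    case False
    hence L: "1 \<le> L" "L \<le> \<theta>" "?g L \<le> int n - int k" using \<open>L \<in> A\<close> by (auto simp: A_def)
    then obtain S where "S \<subseteq> P" "card S = L" "int (card (blocks_meeting S)) \<le> ?g L"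
      using exists_points_meeting_few_blocks by blast
    thus ?thesis using L(3) by (intro exI[of _ S]) auto
  qed
  hence "supported_file_size P B I k \<le> \<theta> - L"
    using supported_file_size_le_diff by blast
  \<comment> \<open>By maximality of L every indicator beyond L equals 1; the earlier indicators can
    only enlarge the sum.\<close>
  also have "\<theta> - L = (\<Sum>l = Suc L..\<theta>. of_bool (int k > int n - ?g l))"
  proof -
    have "int k > int n - ?g l" if "l \<in> {Suc L..\<theta>}" for l
    proof (rule ccontr)
      assume "\<not> ?thesis"
      hence "l \<in> A" using that by (auto simp: A_def)
      hence "l \<le> L" unfolding L_def using A(1) by (rule Max_ge[rotated])
      thus False using that by simp
    qed
    thus ?thesis by simp
  qed
  also have "\<dots> \<le> (\<Sum>l = 1..\<theta>. of_bool (int k > int n - ?g l))"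
    by (intro sum_mono2) auto
  finally show "supported_file_size P B I k
           \<le> (\<Sum>l = 1..\<theta>. of_bool (int k > int n - g' \<alpha> \<theta> \<rho> l))" .
qed

end
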